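(* Let $\mathbb{F}=\mathbb{R}$ or $\mathbb{C}$, let $v_1,\ldots,v_p\in\mathbb{F}^n$, and let $G=G(v_1,\ldots,v_p)=\big(\langle v_i,v_j\rangle\big)_{p\times p}$ be their Gram matrix. (i) If $\mathbb{F}=\mathbb{R}$, then $\det G=\mathcal{V}_p(v_1,\ldots,v_p)^2$. (ii) If $\mathbb{F}=\mathbb{C}$, then $\det G=\mathcal{V}_{2p}(v_1,\mathrm{i}v_1,\ldots,v_p,\mathrm{i}v_p)$.
   Context: $\langle\cdot,\cdot\rangle$ is the canonical inner product on $\mathbb{R}^n$ or the canonical Hermitian product on $\mathbb{C}^n$ (conjugate-linear in the first entry). $\langle\cdot,\cdot\rangle_{\mathbb{R}}=\langle\cdot,\cdot\rangle$ if $\mathbb{F}=\mathbb{R}$, and $\langle\cdot,\cdot\rangle_{\mathbb{R}}=\operatorname{Re}\langle\cdot,\cdot\rangle$ if $\mathbb{F}=\mathbb{C}$ (the Euclidean inner product of the underlying real space $(\mathbb{C}^n)_{\mathbb{R}}=\mathbb{R}^{2n}$). For vectors $v_1,\ldots,v_p\in\mathbb{F}^n$, $\mathcal{V}_p(v_1,\ldots,v_p)$ (also written $\mathcal{V}(v_1,\ldots,v_p)$) is the real $p$-dimensional volume of the parallelotope $\{\sum_{j=1}^p t_jv_j:0\le t_j\le1\}$, defined recursively by $\mathcal{V}(v_1)=\|v_1\|$ and $\mathcal{V}(v_1,\ldots,v_k)=\mathcal{V}(v_1,\ldots,v_{k-1})\cdot\|u_k\|$ for $2\le k\le p$, where $u_k=v_k-\sum_{j=1}^{k-1}c_jv_j$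 with $c_j\in\mathbb{R}$ such that $\langle v_j,u_k\rangle_{\mathbb{R}}=0$ for all $j<k$. *)

theory Defs
  imports "HOL-Analysis.Analysis" "Jordan_Normal_Form.Determinant"
begin

text \<open>
  Families \<open>v\<^sub>1, \<dots>, v\<^sub>p\<close> are given as functions on the natural numbers, of which only the values
  \<open>v 0, \<dots>, v (p - 1)\<close> matter. The canonical inner product on \<open>real ^ 'n\<close> is the library's
  \<^const>\<open>inner\<close>.
\<close>

definition hermitian :: "complex ^ 'n \<Rightarrow> complex ^ 'n \<Rightarrow> complex" where
  "hermitian v w = (\<Sum>i\<in>UNIV. cnj (vec_nth v i) * vec_nth w i)"

text \<open>
  The Euclidean structure of the real space underlying \<open>complex ^ 'n\<close> is the library's
  \<^const>\<open>inner\<close> and \<^const>\<open>norm\<close>.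
\<close>

lemma Re_hermitian_eq_inner: "Re (hermitian v w) = inner v w"
  by (simp add: hermitian_def inner_vec_def inner_complex_def)

lemma hermitian_self_eq_norm: "hermitian v v = complex_of_real ((norm v)\<^sup>2)"
proof (rule complex_eqI)
  show "Re (hermitian v v) = Re (complex_of_real ((norm v)\<^sup>2))"
    by (simp add: Re_hermitian_eq_inner power2_norm_eq_inner)
  show "Im (hermitian v v) = Im (complex_of_real ((norm v)\<^sup>2))"
    by (simp add: hermitian_def mult.commute)
qed

definition gram_matrix :: "('v \<Rightarrow> 'v \<Rightarrow> 'f) \<Rightarrow> nat \<Rightarrow> (nat \<Rightarrow> 'v) \<Rightarrow> 'f Matrix.mat" where
  "gram_matrix ip p v = Matrix.mat p p (\<lambda>(i, j). ip (v i) (v j))"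

definition is_orth_component :: "(nat \<Rightarrow> 'v::real_inner) \<Rightarrow> nat \<Rightarrow> 'v \<Rightarrow> bool" where
  "is_orth_component v k u \<longleftrightarrow>
     (\<exists>c :: nat \<Rightarrow> real. u = v k - (\<Sum>j<k. c j *\<^sub>R v j)) \<and> (\<forall>j<k. inner (v j) u = 0)"

text \<open>
  If \<open>v 0, \<dots>, v (k - 1)\<close> are linearly dependent, the coefficients \<open>c\<close> are not unique, but \<open>u\<close>
  still is.
\<close>

lemma ex1_orth_component:
  fixes v :: "nat \<Rightarrow> 'v::euclidean_space"
  shows "\<exists>!u. is_orth_component v k u"
proof (rule ex_ex1I)
  obtain y z where y: "y \<in> span (v ` {..<k})"
    and z: "\<And>w. w \<in> span (v ` {..<k}) \<Longrightarrow> inner z w = 0" and vk: "v k = y + z"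
    using orthogonal_subspace_decomp_exists[of "v ` {..<k}" "v k"] by (metis Linear_Algebra.orthogonal_def)
  have "\<exists>c. y = (\<Sum>j<k. c j *\<^sub>R v j)"
    using y
  proof (induction rule: span_induct_alt)
    case base
    show ?case by (rule exI[of _ "\<lambda>_. 0"]) simp
  next
    case (step a x y)
    then obtain c i where c: "y = (\<Sum>j<k. c j *\<^sub>R v j)" and i: "i < k" "x = v i" by auto
    have "(\<Sum>j<k. (c j + (if j = i then a else 0)) *\<^sub>R v j)
        = (\<Sum>j<k. c j *\<^sub>R v j + (if j = i then a *\<^sub>R v i else 0))"
      by (rule sum.cong) (auto simp: scaleR_add_left)
    also have "\<dots> = a *\<^sub>R x + y"
      using i by (simp add: sum.distrib c add.commute)
    finally show ?case by metis
  qed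
  then obtain c where c: "y = (\<Sum>j<k. c j *\<^sub>R v j)" ..
  have "\<forall>j<k. inner (v j) z = 0"
    using z[OF span_base] by (metis imageI inner_commute lessThan_iff)
  with c vk show "\<exists>u. is_orth_component v k u"
    unfolding is_orth_component_def by (metis add_diff_cancel_left')
next
  fix u w
  assume uw: "is_orth_component v k u" "is_orth_component v k w"
  then obtain c d where "u = v k - (\<Sum>j<k. c j *\<^sub>R v j)" "w = v k - (\<Sum>j<k. d j *\<^sub>R v j)"
    unfolding is_orth_component_def by blast
  then have e: "u - w = (\<Sum>j<k. (d j - c j) *\<^sub>R v j)"
    by (simp add: scaleR_diff_left sum_subtractf)
  have "inner (u - w) (u - w) = (\<Sum>j<k. (d j - c j) * inner (v j) (u - w))"
    by (subst e) (simp add: inner_sum_left)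
  also have "\<dots> = 0"
    using uw by (intro sum.neutral) (auto simp: is_orth_component_def inner_diff_right)
  finally show "u = w" by simp
qed

definition orth_component :: "(nat \<Rightarrow> 'v::real_inner) \<Rightarrow> nat \<Rightarrow> 'v" where
  "orth_component v k = (THE u. is_orth_component v k u)"

text \<open>The value for the empty family is a convention (empty product).\<close>

fun pvolume :: "nat \<Rightarrow> (nat \<Rightarrow> 'v::real_inner) \<Rightarrow> real" where
  "pvolume 0 v = 1"
| "pvolume (Suc 0) v = norm (v 0)"
| "pvolume (Suc (Suc k)) v = pvolume (Suc k) v * norm (orth_component v (Suc k))"

text \<open>The family \<open>v\<^sub>1, \<i> v\<^sub>1, v\<^sub>2, \<i> v\<^sub>2, \<dots>\<close>\<close>

definition with_i_multiples :: "(nat \<Rightarrow> complex ^ 'n) \<Rightarrow> nat \<Rightarrow> complex ^ 'n" where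
  "with_i_multiples v k = (if even k then v (k div 2) else \<i> *s v (k div 2))"

end

theory Submission
  imports Defs
begin

text \<open>
  The Gram determinant satisfies the same recursion as the volume. Write the last vector as
  \<open>v\<^sub>k = \<Sum>\<^sub>j c\<^sub>j v\<^sub>j + u\<close> with \<open>u\<close> orthogonal to its predecessors. Subtracting \<open>c\<^sub>j\<close> times column
  \<open>j\<close> from the last column of the Gram matrix turns that column into
  \<open>(0, \<dots>, 0, \<langle>v\<^sub>k, u\<rangle>)\<close>, and \<open>\<langle>v\<^sub>k, u\<rangle> = \<parallel>u\<parallel>\<^sup>2\<close>; so adding \<open>v\<^sub>k\<close> multiplies the determinant by
  \<open>\<parallel>u\<parallel>\<^sup>2\<close> (\<open>det_gram_matrix_Suc\<close>).

  In the real case adding \<open>v\<^sub>k\<close> multiplies the volume by \<open>\<parallel>u\<parallel>\<close>, hence the square. In the complex case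
  \<open>w\<^sub>k\<close> contributes the two real vectors \<open>w\<^sub>k\<close> and \<open>\<i> w\<^sub>k\<close> to the volume. The real span of the
  earlier vectors and their \<open>\<i>\<close>-multiples is their complex span, and a vector is real-orthogonal to it
  exactly when it is Hermitian-orthogonal to it. So the real orthogonal component \<open>u\<close> of \<open>w\<^sub>k\<close> is also the
  Hermitian one (\<open>hermitian_orth_decomposition\<close>), and the component of \<open>\<i> w\<^sub>k\<close> is \<open>\<i> u\<close>, which stays
  orthogonal to \<open>w\<^sub>k\<close> because \<open>\<langle>w\<^sub>k, \<i> u\<rangle> = \<i> \<parallel>u\<parallel>\<^sup>2\<close> has real part zero
  (\<open>orth_component_with_i_multiples_odd\<close>). The two factors \<open>\<parallel>u\<parallel>\<close> and \<open>\<parallel>\<i> u\<parallel>\<close> together give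
  \<open>\<parallel>u\<parallel>\<^sup>2\<close>, so here the volume itself, not its square, is the determinant.
\<close>

section \<open>Gram determinants and elimination of the last column\<close>

text \<open>
  Column elimination is right multiplication by a unipotent upper triangular matrix, which has
  determinant 1 and makes the matrix block lower triangular.
\<close>

lemma det_eliminate_last_column:
  fixes a :: "nat \<Rightarrow> nat \<Rightarrow> 'f::comm_ring_1"
  assumes "\<And>i. i < k \<Longrightarrow> a i k = (\<Sum>j<k. a i j * c j)"
  shows "Determinant.det (Matrix.mat (Suc k) (Suc k) (\<lambda>(i, j). a i j))
    = Determinant.det (Matrix.mat k k (\<lambda>(i, j). a i j)) * (a k k - (\<Sum>j<k. a k j * c j))"
proof -
  let ?A = "Matrix.mat (Suc k) (Suc k) (\<lambda>(i, j). a i j)"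
  let ?A' = "Matrix.mat k k (\<lambda>(i, j). a i j)"
  define M where "M = Matrix.mat (Suc k) (Suc k)
    (\<lambda>(i, j). if i = j then 1 else if j = k then - c i else 0)"
  define R where "R = Matrix.mat 1 k (\<lambda>(i, j). a k j)"
  define d where "d = a k k - (\<Sum>j<k. a k j * c j)"
  have M: "M \<in> carrier_mat (Suc k) (Suc k)" and A: "?A \<in> carrier_mat (Suc k) (Suc k)"
    by (auto simp: M_def)
  have "upper_triangular M"
    by (auto simp: M_def)
  then have "Determinant.det M = prod_list (diag_mat M)"
    by (rule det_upper_triangular[OF _ M])
  also have "diag_mat M = map (\<lambda>i. 1) [0..<Suc k]"
    by (auto simp: diag_mat_def M_def simp del: upt_Suc intro!: map_cong)
  finally have detM: "Determinant.det M = 1"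
    by (simp add: map_replicate_const)
  have prod_entry: "(\<Sum>l<Suc k. a i l * M $$ (l, j))
      = (if j = k then a i k - (\<Sum>l<k. a i l * c l) else a i j)" if "j < Suc k" for i j
  proof (cases "j = k")
    case True
    then show ?thesis
      by (simp add: M_def sum_negf)
  next
    case False
    with that have "(\<Sum>l<Suc k. a i l * M $$ (l, j)) = (\<Sum>l<Suc k. if l = j then a i l else 0)"
      by (intro sum.cong) (auto simp: M_def)
    with False that show ?thesis by simp
  qed
  have "?A * M = four_block_mat ?A' (0\<^sub>m k 1) R (Matrix.mat 1 1 (\<lambda>_. d))"
  proof (rule eq_matI)
    fix i j
    assume "i < dim_row (four_block_mat ?A' (0\<^sub>m k 1) R (Matrix.mat 1 1 (\<lambda>_. d)))"
      and "j < dim_col (four_block_mat ?A' (0\<^sub>m k 1) R (Matrix.mat 1 1 (\<lambda>_. d)))"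
    then have ij: "i < Suc k" "j < Suc k" by auto
    then have "(?A * M) $$ (i, j) = (\<Sum>l<Suc k. a i l * M $$ (l, j))"
      by (auto simp: M_def scalar_prod_def atLeast0LessThan simp del: sum.lessThan_Suc intro!: sum.cong)
    also note prod_entry[OF ij(2)]
    finally show "(?A * M) $$ (i, j)
        = four_block_mat ?A' (0\<^sub>m k 1) R (Matrix.mat 1 1 (\<lambda>_. d)) $$ (i, j)"
      using ij assms[of i] by (auto simp: R_def d_def less_Suc_eq)
  qed (auto simp: M_def)
  then have "Determinant.det (?A * M)
      = Determinant.det ?A' * Determinant.det (Matrix.mat 1 1 (\<lambda>_. d))"
    by (simp add: det_four_block_mat_upper_right_zero_col[of _ k] R_def)
  then show ?thesis
    unfolding det_mult[OF A M] detM by (simp add: det_single d_def)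
qed

text \<open>
  With \<open>ip\<close> linear in its second argument, the hypotheses say that \<open>u = v k - (\<Sum>j<k. c j * v j)\<close> is
  orthogonal to the earlier vectors and that \<open>d\<close> is the product of \<open>v k\<close> with \<open>u\<close>. Stated on the Gram
  entries alone, they cover real and Hermitian products alike.
\<close>

lemma det_gram_matrix_Suc:
  fixes ip :: "'v \<Rightarrow> 'v \<Rightarrow> 'f::comm_ring_1"
  assumes "\<And>i. i < k \<Longrightarrow> ip (v i) (v k) = (\<Sum>j<k. ip (v i) (v j) * c j)"
    and "ip (v k) (v k) = (\<Sum>j<k. ip (v k) (v j) * c j) + d"
  shows "Determinant.det (gram_matrix ip (Suc k) v) = Determinant.det (gram_matrix ip k v) * d"
  using det_eliminate_last_column[of k "\<lambda>i j. ip (v i) (v j)" c] assms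
  by (simp add: gram_matrix_def)

lemma det_gram_matrix_0: "Determinant.det (gram_matrix ip 0 v) = 1"
  by (simp add: gram_matrix_def det_dim_zero)

section \<open>The real case\<close>

lemma orth_component_eqI:
  fixes v :: "nat \<Rightarrow> 'v::euclidean_space"
  assumes "is_orth_component v k u"
  shows "orth_component v k = u"
  unfolding orth_component_def using ex1_orth_component assms by (rule the1_equality)

lemma is_orth_component_orth_component:
  fixes v :: "nat \<Rightarrow> 'v::euclidean_space"
  shows "is_orth_component v k (orth_component v k)"
  unfolding orth_component_def by (rule theI'[OF ex1_orth_component])

text \<open>
  The recursion extends to the empty family, since the first vector is its own orthogonal component;
  this lets the inductions below start at 0.
\<close>

lemma pvolume_Suc:
  fixes v :: "nat \<Rightarrow> 'v::euclidean_space"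
  shows "pvolume (Suc k) v = pvolume k v * norm (orth_component v k)"
proof (cases k)
  case 0
  have "orth_component v 0 = v 0"
    by (rule orth_component_eqI) (simp add: is_orth_component_def)
  with 0 show ?thesis by simp
qed simp

lemma det_gram_matrix_inner:
  fixes v :: "nat \<Rightarrow> 'v::euclidean_space"
  shows "Determinant.det (gram_matrix inner p v) = (pvolume p v)\<^sup>2"
proof (induction p)
  case 0
  show ?case by (simp add: det_gram_matrix_0)
next
  case (Suc k)
  define u where "u = orth_component v k"
  obtain c where u: "u = v k - (\<Sum>j<k. c j *\<^sub>R v j)" and orth: "\<And>j. j < k \<Longrightarrow> inner (v j) u = 0"
    using is_orth_component_orth_component[of v k] unfolding is_orth_component_def u_def by blast
  have vk: "v k = (\<Sum>j<k. c j *\<^sub>R v j) + u"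
    by (simp add: u)
  have expand: "inner x (v k) = (\<Sum>j<k. inner x (v j) * c j) + inner x u" for x
    by (simp add: vk inner_add_right inner_sum_right mult.commute)
  have "inner (v k) u = inner u u"
    using orth by (simp add: vk inner_add_left inner_sum_left)
  then have "Determinant.det (gram_matrix inner (Suc k) v)
      = Determinant.det (gram_matrix inner k v) * (norm u)\<^sup>2"
    using orth expand by (intro det_gram_matrix_Suc[of k _ v c]) (simp_all add: power2_norm_eq_inner)
  then show ?case
    by (simp add: Suc.IH pvolume_Suc u_def power_mult_distrib)
qed

section \<open>Hermitian and real orthogonality\<close>

lemma hermitian_add_right: "hermitian x (y + z) = hermitian x y + hermitian x z"
  by (simp add: hermitian_def distrib_left sum.distrib)

lemma hermitian_add_left: "hermitian (x + y) z = hermitian x z + hermitian y z"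
  by (simp add: hermitian_def distrib_right sum.distrib)

lemma hermitian_scale_right: "hermitian x (a *s y) = a * hermitian x y"
  by (simp add: hermitian_def sum_distrib_left mult_ac)

lemma hermitian_scale_left: "hermitian (a *s x) y = cnj a * hermitian x y"
  by (simp add: hermitian_def sum_distrib_left mult_ac)

lemma hermitian_sum_right: "hermitian x (\<Sum>j\<in>J. f j) = (\<Sum>j\<in>J. hermitian x (f j))"
  by (simp add: hermitian_def sum_distrib_left) (rule sum.swap)

lemma hermitian_sum_left: "hermitian (\<Sum>j\<in>J. f j) y = (\<Sum>j\<in>J. hermitian (f j) y)"
  by (simp add: hermitian_def sum_distrib_right) (rule sum.swap)

lemma norm_imaginary_unit_scale: "norm (\<i> *s (x :: complex ^ 'n)) = norm x"
  by (simp add: norm_vec_def norm_mult)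

text \<open>
  Real combinations of \<open>w\<^sub>j\<close> and \<open>\<i> w\<^sub>j\<close> are complex combinations of \<open>w\<^sub>j\<close>, the two real coefficients
  being the real and imaginary parts.
\<close>

lemma sum_with_i_multiples:
  fixes w :: "nat \<Rightarrow> complex ^ 'n"
  shows "(\<Sum>j<2 * k. c j *\<^sub>R with_i_multiples w j)
    = (\<Sum>j<k. Complex (c (2 * j)) (c (2 * j + 1)) *s w j)"
proof (induction k)
  case (Suc k)
  have "c (2 * k) *\<^sub>R w k + c (2 * k + 1) *\<^sub>R (\<i> *s w k)
      = Complex (c (2 * k)) (c (2 * k + 1)) *s w k"
    by (simp add: Finite_Cartesian_Product.vec_eq_iff complex_eq_iff)
  with Suc show ?case
    by (simp add: with_i_multiples_def add.assoc)
qed simp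

text \<open>
  The inner products of \<open>w\<^sub>j\<close> and \<open>\<i> w\<^sub>j\<close> with \<open>u\<close> are the real and imaginary parts of the
  Hermitian product of \<open>w\<^sub>j\<close> with \<open>u\<close>.
\<close>

lemma orth_with_i_multiples_iff:
  "(\<forall>j<2 * k. inner (with_i_multiples w j) u = 0) \<longleftrightarrow> (\<forall>j<k. hermitian (w j) u = 0)"
proof -
  have re: "inner (with_i_multiples w (2 * j)) u = Re (hermitian (w j) u)"
    and im: "inner (with_i_multiples w (2 * j + 1)) u = Im (hermitian (w j) u)" for j
    by (simp_all add: with_i_multiples_def hermitian_scale_left flip: Re_hermitian_eq_inner)
  show ?thesis
  proof (intro iffI allI impI)
    fix j
    assume "\<forall>j<2 * k. inner (with_i_multiples w j) u = 0" and "j < k"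
    then have "inner (with_i_multiples w (2 * j)) u = 0" "inner (with_i_multiples w (2 * j + 1)) u = 0"
      by auto
    then show "hermitian (w j) u = 0"
      by (simp add: re im complex_eq_iff del: One_nat_def add_Suc_right)
  next
    fix j
    assume *: "\<forall>j<k. hermitian (w j) u = 0" and "j < 2 * k"
    then have "hermitian (w (j div 2)) u = 0"
      by (simp add: less_mult_imp_div_less)
    then show "inner (with_i_multiples w j) u = 0"
      using re[of "j div 2"] im[of "j div 2"] by (cases "even j") (auto simp: odd_two_times_div_two_succ)
  qed
qed

section \<open>The complex case\<close>

text \<open>
  Existence of the Hermitian decomposition comes from the real one: its real coefficients pair up into
  complex ones, and its real orthogonality relations into Hermitian ones.
\<close>

lemma hermitian_orth_decomposition:
  fixes w :: "nat \<Rightarrow> complex ^ 'n" and k :: nat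
  defines "u \<equiv> orth_component (with_i_multiples w) (2 * k)"
  obtains a where "w k = (\<Sum>j<k. a j *s w j) + u" and "\<And>j. j < k \<Longrightarrow> hermitian (w j) u = 0"
proof -
  obtain c where u: "u = with_i_multiples w (2 * k) - (\<Sum>j<2 * k. c j *\<^sub>R with_i_multiples w j)"
    and orth: "\<forall>j<2 * k. inner (with_i_multiples w j) u = 0"
    using is_orth_component_orth_component[of "with_i_multiples w" "2 * k"]
    unfolding is_orth_component_def u_def by blast
  have "w k = (\<Sum>j<k. Complex (c (2 * j)) (c (2 * j + 1)) *s w j) + u"
    using u by (simp add: sum_with_i_multiples) (simp add: with_i_multiples_def)
  with orth show ?thesis
    unfolding orth_with_i_multiples_iff by (intro that) auto
qed

lemma hermitian_orth_self:
  assumes "x = (\<Sum>j<k. a j *s w j) + u" and "\<And>j. j < k \<Longrightarrow> hermitian (w j) u = 0"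
  shows "hermitian x u = complex_of_real ((norm u)\<^sup>2)"
  using assms(2) by (simp add: assms(1) hermitian_add_left hermitian_sum_left hermitian_scale_left
      hermitian_self_eq_norm)

lemma orth_component_with_i_multiples_odd:
  fixes w :: "nat \<Rightarrow> complex ^ 'n"
  shows "orth_component (with_i_multiples w) (Suc (2 * k))
    = \<i> *s orth_component (with_i_multiples w) (2 * k)"
proof (rule orth_component_eqI)
  define u where "u = orth_component (with_i_multiples w) (2 * k)"
  obtain a where wk: "w k = (\<Sum>j<k. a j *s w j) + u" and orth: "\<And>j. j < k \<Longrightarrow> hermitian (w j) u = 0"
    using hermitian_orth_decomposition[of w k] unfolding u_def by blast
  \<comment> \<open>The coordinates of \<open>\<i> a\<^sub>j\<close>; \<open>w\<^sub>k\<close> itself, at index \<open>2 * k\<close>, gets coefficient 0, since \<open>\<i> u\<close> is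
    already orthogonal to it.\<close>
  define c where "c = (\<lambda>j. if j = 2 * k then 0
    else if even j then Re (\<i> * a (j div 2)) else Im (\<i> * a (j div 2)))"
  have "\<i> *s w k = (\<Sum>j<k. (\<i> * a j) *s w j) + \<i> *s u"
    by (subst wk) (simp add: Finite_Cartesian_Product.vec_eq_iff distrib_left sum_distrib_left mult.assoc)
  moreover have "(\<Sum>j<k. (\<i> * a j) *s w j) = (\<Sum>j<2 * k. c j *\<^sub>R with_i_multiples w j)"
    unfolding sum_with_i_multiples by (rule sum.cong) (auto simp: c_def complex_eq_iff)
  ultimately have "\<i> *s u = with_i_multiples w (Suc (2 * k))
      - (\<Sum>j<Suc (2 * k). c j *\<^sub>R with_i_multiples w j)"
    by (simp add: c_def with_i_multiples_def)
  moreover have "\<forall>j<2 * k. inner (with_i_multiples w j) (\<i> *s u) = 0"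
    unfolding orth_with_i_multiples_iff using orth by (simp add: hermitian_scale_right)
  moreover have "inner (with_i_multiples w (2 * k)) (\<i> *s u) = 0"
    using hermitian_orth_self[OF wk orth]
    by (simp add: with_i_multiples_def hermitian_scale_right flip: Re_hermitian_eq_inner)
  ultimately show "is_orth_component (with_i_multiples w) (Suc (2 * k)) (\<i> *s u)"
    unfolding is_orth_component_def by (auto simp: less_Suc_eq)
qed

lemma det_gram_matrix_hermitian:
  fixes w :: "nat \<Rightarrow> complex ^ 'n"
  shows "Determinant.det (gram_matrix hermitian p w)
    = complex_of_real (pvolume (2 * p) (with_i_multiples w))"
proof (induction p)
  case 0
  show ?case by (simp add: det_gram_matrix_0)
next
  case (Suc k)
  define u where "u = orth_component (with_i_multiples w) (2 * k)"
  obtain a where wk: "w k = (\<Sum>j<k. a j *s w j) + u" and orth: "\<And>j. j < k \<Longrightarrow> hermitian (w j) u = 0"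
    using hermitian_orth_decomposition[of w k] unfolding u_def by blast
  have expand: "hermitian x (w k) = (\<Sum>j<k. hermitian x (w j) * a j) + hermitian x u" for x
    by (simp add: wk hermitian_add_right hermitian_sum_right hermitian_scale_right mult.commute)
  have "Determinant.det (gram_matrix hermitian (Suc k) w)
      = Determinant.det (gram_matrix hermitian k w) * complex_of_real ((norm u)\<^sup>2)"
    using orth expand hermitian_orth_self[OF wk orth] by (intro det_gram_matrix_Suc[of k _ w a]) simp_all
  moreover have "pvolume (2 * Suc k) (with_i_multiples w)
      = pvolume (2 * k) (with_i_multiples w) * (norm u)\<^sup>2"
    using orth_component_with_i_multiples_odd[of w k]
    by (simp add: pvolume_Suc norm_imaginary_unit_scale power2_eq_square u_def del: pvolume.simps)
  ultimately show ?case
    by (simp add: Suc.IH)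
qed

theorem theorem2p3:
  fixes p :: nat and v :: "nat \<Rightarrow> real ^ 'n" and w :: "nat \<Rightarrow> complex ^ 'm"
  assumes "p \<ge> 1"
  shows "Determinant.det (gram_matrix inner p v) = (pvolume p v)\<^sup>2
    \<and> Determinant.det (gram_matrix hermitian p w)
        = complex_of_real (pvolume (2 * p) (with_i_multiples w))"
  using det_gram_matrix_inner det_gram_matrix_hermitian by blast

end
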